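(* The algebraic theory of quandles is a retract of the algebraic theory of racks: there are morphisms \[ \mathbf{Quan}\xrightarrow{\ \square\ }\mathbf{Rack}\xrightarrow{\ \supset\ }\mathbf{Quan} \] of algebraic theories such that the composition is the identity.
   Context: A rack $(R,\rhd)$ is a set $R$ with a binary operation $\rhd$ such that for every $x\in R$ the left multiplication $y\mapsto x\rhd y$ is bijective and $x\rhd(y\rhd z)=(x\rhd y)\rhd(x\rhd z)$ for all $y,z\in R$. Its canonical automorphism is $\mathrm{F}(x)=x\rhd x$ (this is a rack automorphism). A quandle is a rack with $x\rhd x=x$ for all $x$. Morphisms are maps preserving $\rhd$. $\mathbf{Rack}$ and $\mathbf{Quan}$ denote both the algebraic (Lawvere) theories and their categories of models. A morphism of algebraic theories $\mathbf{T}\to\mathbf{T}'$ is written in the direction of the left adjoint; it is the same as a ('forgetful', right-adjoint) functor from $\mathbf{T}'$-models to $\mathbf{T}$-models commuting with the underlying-set functors. The morphism written $\square\colon\mathbf{Quan}\to\mathbf{Rack}$ (the symbol is an empty box) has right adjoint $(R,\rhd)\mapsto(R,\square)$ with $x\mathbin{\square}y=\mathrm{F}^{-1}(x\rhd y)$, which is a quandle structure on $R$. The morphism $\supset\colon\mathbf{Rack}\to\mathbf{Quan}$ has as right adjoint the inclusion of quandles into racks. *)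

theory Defs
  imports Main
begin

section \<open>Algebraic (Lawvere) theories, their morphisms and their models\<close>

text \<open>
  The objects of a Lawvere theory are the natural numbers, and \<open>n\<close> is the \<open>n\<close>-fold power of \<open>1\<close>
  with projections \<open>prj T n i : n \<rightarrow> 1\<close> for \<open>i < n\<close>; the arrows \<open>n \<rightarrow> 1\<close> are the \<open>n\<close>-ary
  operations. The composite of \<open>f : n \<rightarrow> m\<close> and \<open>g : m \<rightarrow> k\<close> is \<open>cmp T n m k g f : n \<rightarrow> k\<close>.
  The hom-sets need not be disjoint, so all structure is indexed by the objects.
\<close>

record 'h lawvere =
  Hom :: "nat \<Rightarrow> nat \<Rightarrow> 'h set"
  idn :: "nat \<Rightarrow> 'h"
  cmp :: "nat \<Rightarrow> nat \<Rightarrow> nat \<Rightarrow> 'h \<Rightarrow> 'h \<Rightarrow> 'h"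
  prj :: "nat \<Rightarrow> nat \<Rightarrow> 'h"

definition lawvere_theory :: "'h lawvere \<Rightarrow> bool" where
  "lawvere_theory T \<longleftrightarrow>
     (\<forall>n. idn T n \<in> Hom T n n) \<and>
     (\<forall>n m k. \<forall>f\<in>Hom T n m. \<forall>g\<in>Hom T m k. cmp T n m k g f \<in> Hom T n k) \<and>
     (\<forall>n m. \<forall>f\<in>Hom T n m. cmp T n n m f (idn T n) = f \<and> cmp T n m m (idn T m) f = f) \<and>
     (\<forall>n m k l. \<forall>f\<in>Hom T n m. \<forall>g\<in>Hom T m k. \<forall>h\<in>Hom T k l.
        cmp T n k l h (cmp T n m k g f) = cmp T n m l (cmp T m k l h g) f) \<and>
     (\<forall>n. \<forall>i<n. prj T n i \<in> Hom T n 1) \<and>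
     (\<forall>n m. \<forall>fs. (\<forall>i<m. fs i \<in> Hom T n 1) \<longrightarrow>
        (\<exists>!g. g \<in> Hom T n m \<and> (\<forall>i<m. cmp T n m 1 (prj T m i) g = fs i)))"

text \<open>A morphism of theories is the identity on objects and preserves the chosen powers.\<close>

definition theory_morphism ::
  "'h lawvere \<Rightarrow> 'k lawvere \<Rightarrow> (nat \<Rightarrow> nat \<Rightarrow> 'h \<Rightarrow> 'k) \<Rightarrow> bool" where
  "theory_morphism S T \<Phi> \<longleftrightarrow>
     (\<forall>n m. \<forall>f\<in>Hom S n m. \<Phi> n m f \<in> Hom T n m) \<and>
     (\<forall>n. \<Phi> n n (idn S n) = idn T n) \<and>
     (\<forall>n m k. \<forall>f\<in>Hom S n m. \<forall>g\<in>Hom S m k.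
        \<Phi> n k (cmp S n m k g f) = cmp T n m k (\<Phi> m k g) (\<Phi> n m f)) \<and>
     (\<forall>n. \<forall>i<n. \<Phi> n 1 (prj S n i) = prj T n i)"

definition tuples :: "'a set \<Rightarrow> nat \<Rightarrow> 'a list set" where
  "tuples A n = {xs. length xs = n \<and> set xs \<subseteq> A}"

text \<open>
  A model with underlying set \<open>A\<close> is a functor to sets sending \<open>n\<close> to \<open>A\<^sup>n\<close> (here
  \<open>tuples A n\<close>) and the projections to the projections; only the values on arguments in
  \<open>tuples A n\<close> are relevant.
\<close>

definition theory_model ::
  "'h lawvere \<Rightarrow> 'a set \<Rightarrow> (nat \<Rightarrow> nat \<Rightarrow> 'h \<Rightarrow> 'a list \<Rightarrow> 'a list) \<Rightarrow> bool" where
  "theory_model T A M \<longleftrightarrow>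
     (\<forall>n m. \<forall>f\<in>Hom T n m. \<forall>xs\<in>tuples A n. M n m f xs \<in> tuples A m) \<and>
     (\<forall>n. \<forall>xs\<in>tuples A n. M n n (idn T n) xs = xs) \<and>
     (\<forall>n m k. \<forall>f\<in>Hom T n m. \<forall>g\<in>Hom T m k. \<forall>xs\<in>tuples A n.
        M n k (cmp T n m k g f) xs = M m k g (M n m f xs)) \<and>
     (\<forall>n. \<forall>i<n. \<forall>xs\<in>tuples A n. M n 1 (prj T n i) xs = [xs ! i])"

definition same_model ::
  "'h lawvere \<Rightarrow> 'a set \<Rightarrow> (nat \<Rightarrow> nat \<Rightarrow> 'h \<Rightarrow> 'a list \<Rightarrow> 'a list) \<Rightarrow>
     (nat \<Rightarrow> nat \<Rightarrow> 'h \<Rightarrow> 'a list \<Rightarrow> 'a list) \<Rightarrow> bool" where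
  "same_model T A M N \<longleftrightarrow>
     (\<forall>n m. \<forall>f\<in>Hom T n m. \<forall>xs\<in>tuples A n. M n m f xs = N n m f xs)"

text \<open>
  The forgetful functor (the right adjoint) of a morphism of theories \<open>\<Phi> : S \<rightarrow> T\<close> is
  precomposition with \<open>\<Phi>\<close>, from models of \<open>T\<close> to models of \<open>S\<close>; it keeps the underlying set.
\<close>

definition pullback_model ::
  "(nat \<Rightarrow> nat \<Rightarrow> 'h \<Rightarrow> 'k) \<Rightarrow> (nat \<Rightarrow> nat \<Rightarrow> 'k \<Rightarrow> 'a list \<Rightarrow> 'a list) \<Rightarrow>
     nat \<Rightarrow> nat \<Rightarrow> 'h \<Rightarrow> 'a list \<Rightarrow> 'a list" where
  "pullback_model \<Phi> M = (\<lambda>n m f. M n m (\<Phi> n m f))"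


section \<open>Racks and quandles\<close>

definition rack :: "'a set \<Rightarrow> ('a \<Rightarrow> 'a \<Rightarrow> 'a) \<Rightarrow> bool" where
  "rack R r \<longleftrightarrow>
     (\<forall>x\<in>R. bij_betw (r x) R R) \<and>
     (\<forall>x\<in>R. \<forall>y\<in>R. \<forall>z\<in>R. r x (r y z) = r (r x y) (r x z))"

definition quandle :: "'a set \<Rightarrow> ('a \<Rightarrow> 'a \<Rightarrow> 'a) \<Rightarrow> bool" where
  "quandle R r \<longleftrightarrow> rack R r \<and> (\<forall>x\<in>R. r x x = x)"

definition canonical_aut :: "('a \<Rightarrow> 'a \<Rightarrow> 'a) \<Rightarrow> 'a \<Rightarrow> 'a" where
  "canonical_aut r x = r x x"

definition box_op :: "'a set \<Rightarrow> ('a \<Rightarrow> 'a \<Rightarrow> 'a) \<Rightarrow> 'a \<Rightarrow> 'a \<Rightarrow> 'a" where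
  "box_op R r x y = inv_into R (canonical_aut r) (r x y)"


section \<open>The theories of racks and of quandles\<close>

text \<open>
  Bijectivity of the left multiplications is not an equation in \<open>\<rhd>\<close> alone, so the
  equational presentation has a second operation \<open>LInv\<close>: \<open>LInv x y\<close> is the preimage of \<open>y\<close>
  under left multiplication by \<open>x\<close>.
\<close>

datatype rterm = Var nat | Op rterm rterm | LInv rterm rterm

primrec vars :: "rterm \<Rightarrow> nat set" where
  "vars (Var i) = {i}"
| "vars (Op s t) = vars s \<union> vars t"
| "vars (LInv s t) = vars s \<union> vars t"

primrec subst :: "(nat \<Rightarrow> rterm) \<Rightarrow> rterm \<Rightarrow> rterm" where
  "subst \<sigma> (Var i) = \<sigma> i"
| "subst \<sigma> (Op s t) = Op (subst \<sigma> s) (subst \<sigma> t)"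
| "subst \<sigma> (LInv s t) = LInv (subst \<sigma> s) (subst \<sigma> t)"

inductive provably_eq :: "(rterm \<times> rterm) set \<Rightarrow> rterm \<Rightarrow> rterm \<Rightarrow> bool"
  for E where
  ax: "(s, t) \<in> E \<Longrightarrow> provably_eq E (subst \<sigma> s) (subst \<sigma> t)"
| refl: "provably_eq E t t"
| sym: "provably_eq E s t \<Longrightarrow> provably_eq E t s"
| trans: "provably_eq E s t \<Longrightarrow> provably_eq E t u \<Longrightarrow> provably_eq E s u"
| Op: "provably_eq E s s' \<Longrightarrow> provably_eq E t t' \<Longrightarrow> provably_eq E (Op s t) (Op s' t')"
| LInv: "provably_eq E s s' \<Longrightarrow> provably_eq E t t' \<Longrightarrow> provably_eq E (LInv s t) (LInv s' t')"

definition terms_in :: "nat \<Rightarrow> rterm set" where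
  "terms_in n = {t. vars t \<subseteq> {..<n}}"

definition term_rel :: "(rterm \<times> rterm) set \<Rightarrow> nat \<Rightarrow> (rterm \<times> rterm) set" where
  "term_rel E n = {(s, t). s \<in> terms_in n \<and> t \<in> terms_in n \<and> provably_eq E s t}"

text \<open>
  In the theory presented by the equations \<open>E\<close>, an arrow \<open>n \<rightarrow> m\<close> is an \<open>m\<close>-tuple of terms
  in \<open>n\<close> variables modulo \<open>E\<close>, and composition is substitution. The image of a set of mutually
  equivalent terms under \<open>term_rel E n\<close> is their common class, so no representatives are chosen.
\<close>

definition presented_theory :: "(rterm \<times> rterm) set \<Rightarrow> rterm set list lawvere" where
  "presented_theory E = \<lparr>
     Hom = (\<lambda>n m. tuples (terms_in n // term_rel E n) m),
     idn = (\<lambda>n. map (\<lambda>i. term_rel E n `` {Var i}) [0..<n]),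
     cmp = (\<lambda>n m k g f. map (\<lambda>C. term_rel E n ``
              {subst \<sigma> t | \<sigma> t. t \<in> C \<and> (\<forall>i<m. \<sigma> i \<in> f ! i)}) g),
     prj = (\<lambda>n i. [term_rel E n `` {Var i}]) \<rparr>"

definition rack_eqs :: "(rterm \<times> rterm) set" where
  "rack_eqs = (let x = Var 0; y = Var 1; z = Var 2 in
     {(Op x (LInv x y), y),
      (LInv x (Op x y), y),
      (Op x (Op y z), Op (Op x y) (Op x z))})"

definition quandle_eqs :: "(rterm \<times> rterm) set" where
  "quandle_eqs = insert (Op (Var 0) (Var 0), Var 0) rack_eqs"

definition Rack :: "rterm set list lawvere" where
  "Rack = presented_theory rack_eqs"

definition Quan :: "rterm set list lawvere" where
  "Quan = presented_theory quandle_eqs"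

text \<open>The map on arrows into the theory presented by \<open>E\<close> induced by a translation of terms.\<close>

definition induced_map ::
  "(rterm \<times> rterm) set \<Rightarrow> (rterm \<Rightarrow> rterm) \<Rightarrow>
     nat \<Rightarrow> nat \<Rightarrow> rterm set list \<Rightarrow> rterm set list" where
  "induced_map E \<tau> n m f = map (\<lambda>C. term_rel E n `` (\<tau> ` C)) f"

text \<open>
  In a rack, \<open>F\<^sup>-\<^sup>1 x\<close> is the preimage of \<open>x\<close> under left multiplication by \<open>x\<close> itself: if
  \<open>x \<rhd> y = x\<close>, then \<open>x \<rhd> (y \<rhd> y) = x \<rhd> x\<close>, so \<open>y \<rhd> y = x\<close>.
  Solving \<open>F\<^sup>-\<^sup>1 (x \<rhd> y) = z\<close> for \<open>y\<close> gives the clause for \<open>LInv\<close>.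
\<close>

definition F_term :: "rterm \<Rightarrow> rterm" where
  "F_term t = Op t t"

definition F_inv_term :: "rterm \<Rightarrow> rterm" where
  "F_inv_term t = LInv t t"

primrec box_term :: "rterm \<Rightarrow> rterm" where
  "box_term (Var i) = Var i"
| "box_term (Op s t) = F_inv_term (Op (box_term s) (box_term t))"
| "box_term (LInv s t) = LInv (box_term s) (F_term (box_term t))"

definition box_mor :: "nat \<Rightarrow> nat \<Rightarrow> rterm set list \<Rightarrow> rterm set list" where
  "box_mor = induced_map rack_eqs box_term"

definition supset_mor :: "nat \<Rightarrow> nat \<Rightarrow> rterm set list \<Rightarrow> rterm set list" where
  "supset_mor = induced_map quandle_eqs (\<lambda>t. t)"

primrec eval_term :: "'a set \<Rightarrow> ('a \<Rightarrow> 'a \<Rightarrow> 'a) \<Rightarrow> 'a list \<Rightarrow> rterm \<Rightarrow> 'a" where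
  "eval_term R r xs (Var i) = xs ! i"
| "eval_term R r xs (Op s t) = r (eval_term R r xs s) (eval_term R r xs t)"
| "eval_term R r xs (LInv s t) =
     inv_into R (r (eval_term R r xs s)) (eval_term R r xs t)"

text \<open>
  A rack (or quandle) \<open>(R, r)\<close> as a model of \<open>Rack\<close> (or \<open>Quan\<close>): all terms in a class have
  the same value at a given tuple, and \<open>the_elem\<close> extracts that value.
\<close>

definition model_of ::
  "'a set \<Rightarrow> ('a \<Rightarrow> 'a \<Rightarrow> 'a) \<Rightarrow>
     nat \<Rightarrow> nat \<Rightarrow> rterm set list \<Rightarrow> 'a list \<Rightarrow> 'a list" where
  "model_of R r n m f xs = map (\<lambda>C. the_elem (eval_term R r xs ` C)) f"

end

theory Submission
  imports Defs
begin

text \<open>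
  Everything reduces to one computation: if \<open>r\<close>, \<open>l\<close> satisfy the rack equations, then
  \<open>F\<^sup>-\<^sup>1 x = l x x\<close> inverts \<open>F x = r x x\<close>, the map \<open>F\<^sup>-\<^sup>1\<close> commutes with left multiplications, and
  acting by \<open>F x\<close> is the same as acting by \<open>x\<close>; hence \<open>F\<^sup>-\<^sup>1 (r x y)\<close> and \<open>l x (F y)\<close> satisfy the
  quandle equations. Applied to a rack \<open>R\<close>, this is the quandle structure on \<open>R\<close>; applied to the
  term algebra, it says that the translation of terms respects provable equality. In a quandle
  \<open>F\<close> is the identity, so translating changes nothing there.
\<close>

section \<open>Algebras and provable equality\<close>

primrec eval_alg :: "('a \<Rightarrow> 'a \<Rightarrow> 'a) \<Rightarrow> ('a \<Rightarrow> 'a \<Rightarrow> 'a) \<Rightarrow> (nat \<Rightarrow> 'a) \<Rightarrow> rterm \<Rightarrow> 'a" where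
  "eval_alg r l \<rho> (Var i) = \<rho> i"
| "eval_alg r l \<rho> (Op s t) = r (eval_alg r l \<rho> s) (eval_alg r l \<rho> t)"
| "eval_alg r l \<rho> (LInv s t) = l (eval_alg r l \<rho> s) (eval_alg r l \<rho> t)"

text \<open>The second operation \<open>l\<close> is a free parameter instead of
  \<open>inv_into\<close>, so that one notion covers a rack with its left inverses, the algebra of
  terms modulo equations, and the box structure on either.\<close>

definition satisfies ::
  "'a set \<Rightarrow> ('a \<Rightarrow> 'a \<Rightarrow> 'a) \<Rightarrow> ('a \<Rightarrow> 'a \<Rightarrow> 'a) \<Rightarrow> (rterm \<times> rterm) set \<Rightarrow> bool" where
  "satisfies A r l E \<longleftrightarrow>
     (\<forall>x\<in>A. \<forall>y\<in>A. r x y \<in> A \<and> l x y \<in> A) \<and>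
     (\<forall>(s, t)\<in>E. \<forall>\<rho>. range \<rho> \<subseteq> A \<longrightarrow> eval_alg r l \<rho> s = eval_alg r l \<rho> t)"

lemma eval_alg_in:
  assumes "satisfies A r l E" "\<And>i. i \<in> vars t \<Longrightarrow> \<rho> i \<in> A"
  shows "eval_alg r l \<rho> t \<in> A"
  using assms(2) by (induction t) (use assms(1) in \<open>auto simp: satisfies_def\<close>)

lemma eval_alg_cong:
  "(\<And>i. i \<in> vars t \<Longrightarrow> \<rho> i = \<rho>' i) \<Longrightarrow> eval_alg r l \<rho> t = eval_alg r l \<rho>' t"
  by (induction t) auto

lemma eval_alg_subst:
  "eval_alg r l \<rho> (subst \<sigma> t) = eval_alg r l (\<lambda>i. eval_alg r l \<rho> (\<sigma> i)) t"
  by (induction t) auto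

text \<open>Soundness of equational logic. Only the axiom case has content: the value of a
  substitution instance is the value of the axiom at the assignment
  \<open>\<lambda>i. eval_alg r l \<rho> (\<sigma> i)\<close>, which again stays in
  \<open>A\<close>.\<close>

lemma eval_alg_provably_eq:
  assumes "satisfies A r l E" "provably_eq E s t" "range \<rho> \<subseteq> A"
  shows "eval_alg r l \<rho> s = eval_alg r l \<rho> t"
  using assms(2)
proof induction
  case (ax s t \<sigma>)
  have "range (\<lambda>i. eval_alg r l \<rho> (\<sigma> i)) \<subseteq> A"
    using assms(1,3) by (auto intro!: eval_alg_in)
  then show ?case
    using ax assms(1) unfolding satisfies_def eval_alg_subst by blast
qed auto

text \<open>There are no constants, so no term lives in the empty context. This is what makes
  \<open>\<rho> 0\<close> a legitimate default value in the next lemma.\<close>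

lemma vars_nonempty: "vars t \<noteq> {}"
  by (induction t) auto

text \<open>A tuple \<open>xs\<close> yields elements \<open>xs ! i\<close> of the carrier only for
  \<open>i < n\<close>; soundness in this form applies to such assignments.\<close>

lemma eval_alg_provably_eq_terms_in:
  assumes "satisfies A r l E" "provably_eq E s t" "s \<in> terms_in n" "t \<in> terms_in n"
    and "\<And>i. i < n \<Longrightarrow> \<rho> i \<in> A"
  shows "eval_alg r l \<rho> s = eval_alg r l \<rho> t"
proof -
  \<comment> \<open>A derivation may use variables outside the context, so \<open>\<rho>\<close> is redefined there.\<close>
  define \<rho>' where "\<rho>' i = (if i < n then \<rho> i else \<rho> 0)" for i
  have "0 < n"
    using vars_nonempty[of s] assms(3) by (cases n) (auto simp: terms_in_def)
  then have "range \<rho>' \<subseteq> A"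
    using assms(5) by (auto simp: \<rho>'_def)
  with assms(1,2) have "eval_alg r l \<rho>' s = eval_alg r l \<rho>' t"
    by (rule eval_alg_provably_eq)
  moreover have "eval_alg r l \<rho>' u = eval_alg r l \<rho> u" if "u \<in> terms_in n" for u
    using that by (intro eval_alg_cong) (auto simp: \<rho>'_def terms_in_def)
  ultimately show ?thesis
    using assms(3,4) by simp
qed

section \<open>The term algebra of a set of equations\<close>

definition eq_class :: "(rterm \<times> rterm) set \<Rightarrow> rterm \<Rightarrow> rterm set" where
  "eq_class E s = {t. provably_eq E s t}"

text \<open>Taking the union over all representatives avoids a choice; on two classes the union is a
  single class because provable equality is a congruence.\<close>

definition class_op :: "(rterm \<times> rterm) set \<Rightarrow> rterm set \<Rightarrow> rterm set \<Rightarrow> rterm set" where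
  "class_op E C D = (\<Union>s\<in>C. \<Union>t\<in>D. eq_class E (Op s t))"

definition class_linv :: "(rterm \<times> rterm) set \<Rightarrow> rterm set \<Rightarrow> rterm set \<Rightarrow> rterm set" where
  "class_linv E C D = (\<Union>s\<in>C. \<Union>t\<in>D. eq_class E (LInv s t))"

lemma eq_class_eq_iff: "eq_class E s = eq_class E t \<longleftrightarrow> provably_eq E s t"
  unfolding eq_class_def
  by (auto intro: provably_eq.refl provably_eq.sym provably_eq.trans)

lemma class_op_eq_class: "class_op E (eq_class E s) (eq_class E t) = eq_class E (Op s t)"
  unfolding class_op_def eq_class_def
  by (blast intro: provably_eq.refl provably_eq.trans provably_eq.Op)

lemma class_linv_eq_class: "class_linv E (eq_class E s) (eq_class E t) = eq_class E (LInv s t)"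
  unfolding class_linv_def eq_class_def
  by (blast intro: provably_eq.refl provably_eq.trans provably_eq.LInv)

lemma eval_alg_eq_class:
  "eval_alg (class_op E) (class_linv E) (\<lambda>i. eq_class E (\<sigma> i)) t = eq_class E (subst \<sigma> t)"
  by (induction t) (auto simp: class_op_eq_class class_linv_eq_class)

text \<open>An assignment into classes lifts to a substitution \<open>\<sigma>\<close>, and
  evaluation becomes the class of the substituted term. An axiom thus holds at the assignment
  because its instance under \<open>\<sigma>\<close> is derivable by rule \<open>ax\<close>. Through
  this algebra, identities between values turn into derivations.\<close>

lemma satisfies_term_algebra:
  "satisfies (range (eq_class E)) (class_op E) (class_linv E) E"
proof -
  have "eval_alg (class_op E) (class_linv E) \<rho> s = eval_alg (class_op E) (class_linv E) \<rho> t"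
    if "(s, t) \<in> E" "range \<rho> \<subseteq> range (eq_class E)" for s t \<rho>
  proof -
    have "\<forall>i. \<exists>u. \<rho> i = eq_class E u"
      using that(2) by (auto simp: image_subset_iff)
    then obtain \<sigma> where "\<rho> = (\<lambda>i. eq_class E (\<sigma> i))"
      by metis
    then show ?thesis
      using that(1) by (simp add: eval_alg_eq_class eq_class_eq_iff provably_eq.ax)
  qed
  then show ?thesis
    unfolding satisfies_def by (auto simp: class_op_eq_class class_linv_eq_class)
qed

section \<open>Substitution and provable equality\<close>

lemma subst_subst: "subst \<sigma> (subst \<tau> t) = subst (\<lambda>i. subst \<sigma> (\<tau> i)) t"
  by (induction t) auto

lemma subst_cong: "(\<And>i. i \<in> vars t \<Longrightarrow> \<sigma> i = \<tau> i) \<Longrightarrow> subst \<sigma> t = subst \<tau> t"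
  by (induction t) auto

lemma subst_Var: "subst Var t = t"
  by (induction t) auto

lemma vars_subst: "vars (subst \<sigma> t) = (\<Union>i\<in>vars t. vars (\<sigma> i))"
  by (induction t) auto

lemma subst_in_terms_in:
  "t \<in> terms_in m \<Longrightarrow> (\<And>i. i < m \<Longrightarrow> \<sigma> i \<in> terms_in n) \<Longrightarrow> subst \<sigma> t \<in> terms_in n"
  by (fastforce simp: terms_in_def vars_subst)

lemma provably_eq_subst: "provably_eq E s t \<Longrightarrow> provably_eq E (subst \<sigma> s) (subst \<sigma> t)"
  by (induction rule: provably_eq.induct)
    (auto simp: subst_subst intro: provably_eq.intros)

lemma provably_eq_subst_cong:
  "(\<And>i. i \<in> vars t \<Longrightarrow> provably_eq E (\<sigma> i) (\<tau> i)) \<Longrightarrow> provably_eq E (subst \<sigma> t) (subst \<tau> t)"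
  by (induction t) (auto intro: provably_eq.Op provably_eq.LInv)

lemma provably_eq_mono: "provably_eq E s t \<Longrightarrow> E \<subseteq> E' \<Longrightarrow> provably_eq E' s t"
  by (induction rule: provably_eq.induct) (auto intro: provably_eq.intros)


section \<open>Presented theories\<close>

abbreviation term_class :: "(rterm \<times> rterm) set \<Rightarrow> nat \<Rightarrow> rterm \<Rightarrow> rterm set" where
  "term_class E n t \<equiv> term_rel E n `` {t}"

lemma mem_term_rel:
  "(s, t) \<in> term_rel E n \<longleftrightarrow> s \<in> terms_in n \<and> t \<in> terms_in n \<and> provably_eq E s t"
  by (simp add: term_rel_def)

text \<open>\<open>cmp\<close> and \<open>induced_map\<close> are defined as images of sets of terms
  under \<open>term_rel\<close>; this replaces such an image by the class of one representative.
  Transitivity gives one inclusion, and any member of the nonempty \<open>S\<close> gives the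
  other.\<close>

lemma term_rel_Image:
  assumes "t \<in> terms_in n" "S \<noteq> {}"
    and "\<And>s. s \<in> S \<Longrightarrow> s \<in> terms_in n \<and> provably_eq E t s"
  shows "term_rel E n `` S = term_class E n t"
proof (intro equalityI subsetI)
  fix u assume "u \<in> term_class E n t"
  moreover obtain s where "s \<in> S"
    using assms(2) by blast
  ultimately show "u \<in> term_rel E n `` S"
    using assms(3) by (intro ImageI[of s])
      (auto simp: mem_term_rel intro: provably_eq.sym provably_eq.trans)
next
  fix u assume "u \<in> term_rel E n `` S"
  then obtain s where "s \<in> S" "u \<in> terms_in n" "provably_eq E s u"
    by (auto simp: mem_term_rel)
  then show "u \<in> term_class E n t"
    using assms(1) assms(3)[of s] by (auto simp: mem_term_rel intro: provably_eq.trans)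
qed

lemma term_class_eqI:
  "s \<in> terms_in n \<Longrightarrow> t \<in> terms_in n \<Longrightarrow> provably_eq E s t \<Longrightarrow> term_class E n s = term_class E n t"
  by (rule term_rel_Image) (auto intro: provably_eq.sym)

lemma Var_in_terms_in: "i < n \<Longrightarrow> Var i \<in> terms_in n"
  by (simp add: terms_in_def)

text \<open>Picking a representative in every entry lifts a tuple of classes to a tuple of terms.
  Through \<open>HomE\<close> and \<open>HomI\<close>, arrows are handled as lists of terms.\<close>

lemma Hom_presented:
  "Hom (presented_theory E) n m = map (term_class E n) ` tuples (terms_in n) m"
proof -
  have "terms_in n // term_rel E n = term_class E n ` terms_in n"
    by (auto simp: quotient_def)
  moreover have "tuples (g ` B) m = map g ` tuples B m" for g :: "rterm \<Rightarrow> rterm set" and B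
  proof (intro equalityI subsetI)
    fix xs assume xs: "xs \<in> tuples (g ` B) m"
    then have "xs \<in> lists (g ` B)"
      by (auto simp: tuples_def)
    then obtain ys where "ys \<in> lists B" "xs = map g ys"
      by (auto simp: lists_image)
    with xs show "xs \<in> map g ` tuples B m"
      by (auto simp: tuples_def)
  qed (fastforce simp: tuples_def)
  ultimately show ?thesis
    by (simp add: presented_theory_def)
qed

lemma HomE:
  assumes "f \<in> Hom (presented_theory E) n m"
  obtains ts where "length ts = m" "set ts \<subseteq> terms_in n" "f = map (term_class E n) ts"
  using assms by (auto simp: Hom_presented tuples_def)

lemma HomI:
  "length ts = m \<Longrightarrow> set ts \<subseteq> terms_in n \<Longrightarrow>
    map (term_class E n) ts \<in> Hom (presented_theory E) n m"
  by (auto simp: Hom_presented tuples_def)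

lemma idn_presented: "idn (presented_theory E) n = map (term_class E n) (map Var [0..<n])"
  by (simp add: presented_theory_def)

lemma prj_presented: "prj (presented_theory E) n i = map (term_class E n) [Var i]"
  by (simp add: presented_theory_def)

text \<open>Composition is independent of representatives: changing the outer term is covered by
  closure of derivations under substitution, changing the substituted terms by congruence.\<close>

lemma cmp_presented:
  assumes "length ts = m" "set ts \<subseteq> terms_in n" "set us \<subseteq> terms_in m"
  shows "cmp (presented_theory E) n m k (map (term_class E m) us) (map (term_class E n) ts) =
    map (term_class E n) (map (subst (\<lambda>i. ts ! i)) us)"
proof -
  have ts: "ts ! i \<in> terms_in n" if "i < m" for i
    using that assms(1,2) by auto
  have "term_rel E n `` {subst \<sigma> t | \<sigma> t. t \<in> term_class E m u \<and>
          (\<forall>i<m. \<sigma> i \<in> map (term_class E n) ts ! i)} =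
        term_class E n (subst (\<lambda>i. ts ! i) u)" (is "_ `` ?S = _") if u: "u \<in> terms_in m" for u
  proof (rule term_rel_Image)
    show "subst (\<lambda>i. ts ! i) u \<in> terms_in n"
      using u ts by (rule subst_in_terms_in)
    have "subst (\<lambda>i. ts ! i) u \<in> ?S"
      using u ts assms(1) by (fastforce simp: mem_term_rel intro: provably_eq.refl)
    then show "?S \<noteq> {}"
      by blast
    fix s assume "s \<in> ?S"
    then obtain \<sigma> t where s: "s = subst \<sigma> t" and t: "t \<in> terms_in m" "provably_eq E u t"
      and \<sigma>: "\<And>i. i < m \<Longrightarrow> \<sigma> i \<in> terms_in n \<and> provably_eq E (ts ! i) (\<sigma> i)"
      using u ts assms(1) by (auto simp: mem_term_rel)
    have "s \<in> terms_in n"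
      unfolding s using t(1) \<sigma> by (blast intro: subst_in_terms_in)
    moreover have "provably_eq E (subst (\<lambda>i. ts ! i) t) (subst \<sigma> t)"
      using t(1) \<sigma> by (intro provably_eq_subst_cong) (auto simp: terms_in_def)
    ultimately show "s \<in> terms_in n \<and> provably_eq E (subst (\<lambda>i. ts ! i) u) s"
      using provably_eq_subst[OF t(2)] unfolding s by (blast intro: provably_eq.trans)
  qed
  then show ?thesis
    using assms(3) by (simp add: presented_theory_def subset_iff)
qed

lemma map_subst_in_terms_in:
  assumes "length ts = m" "set ts \<subseteq> terms_in n" "set us \<subseteq> terms_in m"
  shows "set (map (subst (\<lambda>i. ts ! i)) us) \<subseteq> terms_in n"
proof -
  have "subst (\<lambda>i. ts ! i) u \<in> terms_in n" if "u \<in> set us" for u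
    using that assms by (intro subst_in_terms_in[of u m]) auto
  then show ?thesis
    by auto
qed

text \<open>On representatives, the category laws are the unit and associativity laws of
  substitution. An arrow into \<open>m\<close> is the list of its composites with the projections,
  which gives the universal property.\<close>

lemma lawvere_theory_presented: "lawvere_theory (presented_theory E)"
  unfolding lawvere_theory_def
proof (intro conjI allI ballI impI)
  let ?T = "presented_theory E"
  show "idn ?T n \<in> Hom ?T n n" for n
    unfolding idn_presented by (rule HomI) (auto simp: Var_in_terms_in)
  show "prj ?T n i \<in> Hom ?T n 1" if "i < n" for n i
    using that unfolding prj_presented by (intro HomI) (auto simp: Var_in_terms_in)
  show "cmp ?T n m k g f \<in> Hom ?T n k" if "f \<in> Hom ?T n m" "g \<in> Hom ?T m k" for n m k f g
  proof -
    obtain ts us where ts: "length ts = m" "set ts \<subseteq> terms_in n" "f = map (term_class E n) ts"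
      and us: "length us = k" "set us \<subseteq> terms_in m" "g = map (term_class E m) us"
      using \<open>f \<in> _\<close> \<open>g \<in> _\<close> by (elim HomE)
    show ?thesis
      unfolding ts(3) us(3) cmp_presented[OF ts(1,2) us(2)]
      using us(1) map_subst_in_terms_in[OF ts(1,2) us(2)] by (intro HomI) auto
  qed
  fix n m f assume "f \<in> Hom ?T n m"
  then obtain ts where ts: "length ts = m" "set ts \<subseteq> terms_in n" "f = map (term_class E n) ts"
    by (rule HomE)
  \<comment> \<open>From position \<open>n\<close> on, the entries of \<open>map Var [0..<n]\<close>
    are unspecified, so it is compared with \<open>Var\<close> only on the variables of
    \<open>t\<close>.\<close>
  have "subst (\<lambda>i. map Var [0..<n] ! i) t = t" if "t \<in> set ts" for t
  proof -
    have "subst (\<lambda>i. map Var [0..<n] ! i) t = subst Var t"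
      using that ts(2) by (intro subst_cong) (fastforce simp: terms_in_def)
    then show ?thesis
      by (simp add: subst_Var)
  qed
  moreover have "set (map Var [0..<n]) \<subseteq> terms_in n" for n
    by (auto simp: Var_in_terms_in)
  moreover have "map (subst ((!) ts)) (map Var [0..<m]) = ts"
    using ts(1) by (auto simp: list_eq_iff_nth_eq)
  ultimately show "cmp ?T n n m f (idn ?T n) = f" "cmp ?T n m m (idn ?T m) f = f"
    unfolding idn_presented ts(3)
    using ts(1,2) by (simp_all add: cmp_presented cong: map_cong del: map_map)
next
  let ?T = "presented_theory E"
  fix n m k l f g h
  assume "f \<in> Hom ?T n m" "g \<in> Hom ?T m k" "h \<in> Hom ?T k l"
  then obtain ts us vs where
    ts: "length ts = m" "set ts \<subseteq> terms_in n" "f = map (term_class E n) ts"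
    and us: "length us = k" "set us \<subseteq> terms_in m" "g = map (term_class E m) us"
    and vs: "length vs = l" "set vs \<subseteq> terms_in k" "h = map (term_class E k) vs"
    by (elim HomE)
  \<comment> \<open>Associativity is \<open>subst_subst\<close>, once \<open>(!)\<close> is moved
    past \<open>map\<close>; this is sound below \<open>length us = k\<close>, hence on the
    variables of \<open>v\<close>.\<close>
  have "subst ((!) (map (subst ((!) ts)) us)) v = subst ((!) ts) (subst ((!) us) v)"
    if "v \<in> set vs" for v
    unfolding subst_subst using that us(1) vs(2) by (intro subst_cong) (fastforce simp: terms_in_def)
  then have "map (subst ((!) (map (subst ((!) ts)) us))) vs =
      map (subst ((!) ts)) (map (subst ((!) us)) vs)"
    by simp
  then show "cmp ?T n k l h (cmp ?T n m k g f) = cmp ?T n m l (cmp ?T m k l h g) f"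
    unfolding ts(3) us(3) vs(3)
    using ts(1,2) us(1,2) vs(1,2) map_subst_in_terms_in[OF ts(1,2) us(2)]
      map_subst_in_terms_in[OF us(1,2) vs(2)]
    by (simp only: cmp_presented length_map)
next
  let ?T = "presented_theory E"
  fix n m :: nat and fs assume fs: "\<forall>i<m. fs i \<in> Hom ?T n 1"
  have cmp_prj: "cmp ?T n m 1 (prj ?T m i) g = [g ! i]" if g: "g \<in> Hom ?T n m" and i: "i < m" for g i
  proof -
    obtain ts where ts: "length ts = m" "set ts \<subseteq> terms_in n" "g = map (term_class E n) ts"
      using g by (rule HomE)
    have "set [Var i] \<subseteq> terms_in m"
      using i by (simp add: Var_in_terms_in)
    with ts(1,2) show ?thesis
      unfolding prj_presented ts(3) using i by (simp only: cmp_presented) simp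
  qed
  \<comment> \<open>Each \<open>fs i\<close> is a one-entry list. By \<open>cmp_prj\<close> the
    mediating arrow must have the entry of \<open>fs i\<close> at position \<open>i\<close>, which
    forces this list.\<close>
  let ?g = "map (\<lambda>i. hd (fs i)) [0..<m]"
  have fs_hd: "fs i = [hd (fs i)]" "hd (fs i) \<in> terms_in n // term_rel E n" if "i < m" for i
  proof -
    have "length (fs i) = 1 \<and> set (fs i) \<subseteq> terms_in n // term_rel E n"
      using fs that by (auto simp: presented_theory_def tuples_def)
    then show "fs i = [hd (fs i)]" "hd (fs i) \<in> terms_in n // term_rel E n"
      by (cases "fs i"; simp)+
  qed
  show "\<exists>!g. g \<in> Hom ?T n m \<and> (\<forall>i<m. cmp ?T n m 1 (prj ?T m i) g = fs i)"
  proof (rule ex1I[of _ ?g])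
    have g: "?g \<in> Hom ?T n m"
      using fs_hd(2) by (auto simp: presented_theory_def tuples_def)
    then show "?g \<in> Hom ?T n m \<and> (\<forall>i<m. cmp ?T n m 1 (prj ?T m i) ?g = fs i)"
      using fs_hd(1) by (simp add: cmp_prj del: One_nat_def)
  next
    fix g assume g: "g \<in> Hom ?T n m \<and> (\<forall>i<m. cmp ?T n m 1 (prj ?T m i) g = fs i)"
    then have "length g = m"
      by (auto simp: presented_theory_def tuples_def)
    moreover have "g ! i = hd (fs i)" if "i < m" for i
      using g that cmp_prj[of g i] by (metis list.sel(1))
    ultimately show "g = ?g"
      by (simp add: list_eq_iff_nth_eq)
  qed
qed

section \<open>Morphisms of theories induced by translations of terms\<close>

locale translation =
  fixes E E' :: "(rterm \<times> rterm) set" and \<tau> :: "rterm \<Rightarrow> rterm"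
  assumes translate_Var: "\<tau> (Var i) = Var i"
    and vars_translate: "vars (\<tau> t) = vars t"
    and translate_subst: "\<tau> (subst \<sigma> t) = subst (\<lambda>i. \<tau> (\<sigma> i)) (\<tau> t)"
    and translate_eq: "provably_eq E s t \<Longrightarrow> provably_eq E' (\<tau> s) (\<tau> t)"
begin

lemma translate_in_terms_in: "\<tau> t \<in> terms_in n \<longleftrightarrow> t \<in> terms_in n"
  by (simp add: terms_in_def vars_translate)

lemma induced_map_classes:
  assumes "set ts \<subseteq> terms_in n"
  shows "induced_map E' \<tau> n m (map (term_class E n) ts) = map (term_class E' n) (map \<tau> ts)"
proof -
  have "term_rel E' n `` (\<tau> ` term_class E n t) = term_class E' n (\<tau> t)" if "t \<in> terms_in n" for t
  proof (rule term_rel_Image)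
    show "\<tau> ` term_class E n t \<noteq> {}"
      using that by (auto simp: term_rel_def intro: provably_eq.refl)
  qed (use that in \<open>auto simp: mem_term_rel translate_in_terms_in intro: translate_eq\<close>)
  then show ?thesis
    using assms by (auto simp: induced_map_def)
qed

text \<open>Each assumption on \<open>\<tau>\<close> has its task: \<open>translate_eq\<close> makes
  the map well defined on classes, \<open>vars_translate\<close> keeps contexts,
  \<open>translate_Var\<close> handles identities and projections, and
  \<open>translate_subst\<close> handles composites.\<close>

lemma theory_morphism_induced_map:
  "theory_morphism (presented_theory E) (presented_theory E') (induced_map E' \<tau>)"
  unfolding theory_morphism_def
proof (intro conjI allI ballI impI)
  let ?S = "presented_theory E" and ?T = "presented_theory E'"
  have sub: "set (map \<tau> ts) \<subseteq> terms_in n" if "set ts \<subseteq> terms_in n" for ts n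
    using that by (auto simp: translate_in_terms_in)
  show "induced_map E' \<tau> n m f \<in> Hom ?T n m" if "f \<in> Hom ?S n m" for n m f
    using that
  proof (rule HomE)
    fix ts assume ts: "length ts = m" "set ts \<subseteq> terms_in n" "f = map (term_class E n) ts"
    then show ?thesis
      unfolding ts(3) induced_map_classes[OF ts(2)] by (intro HomI sub) simp_all
  qed
  have "set (map Var [0..<n]) \<subseteq> terms_in n" for n
    by (auto simp: Var_in_terms_in)
  then show "induced_map E' \<tau> n n (idn ?S n) = idn ?T n" for n
    by (simp add: idn_presented induced_map_classes del: map_map) (simp add: translate_Var)
  have "set [Var i] \<subseteq> terms_in n" if "i < n" for i n
    using that by (auto simp: Var_in_terms_in)
  then show "induced_map E' \<tau> n 1 (prj ?S n i) = prj ?T n i" if "i < n" for n i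
    unfolding prj_presented using that by (simp only: induced_map_classes) (simp add: translate_Var)
  fix n m k f g assume "f \<in> Hom ?S n m" "g \<in> Hom ?S m k"
  then obtain ts us where ts: "length ts = m" "set ts \<subseteq> terms_in n" "f = map (term_class E n) ts"
    and us: "length us = k" "set us \<subseteq> terms_in m" "g = map (term_class E m) us"
    by (elim HomE)
  \<comment> \<open>After \<open>translate_subst\<close>, it remains to move \<open>\<tau>\<close>
    into the list, which is valid below \<open>length ts = m\<close>; \<open>\<tau> u\<close> has
    the same variables as \<open>u\<close>, all below \<open>m\<close>.\<close>
  have "\<tau> (subst ((!) ts) u) = subst ((!) (map \<tau> ts)) (\<tau> u)" if "u \<in> set us" for u
    unfolding translate_subst using that ts(1) us(2)
    by (intro subst_cong) (fastforce simp: terms_in_def vars_translate)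
  then have eq: "map \<tau> (map (subst ((!) ts)) us) = map (subst ((!) (map \<tau> ts))) (map \<tau> us)"
    by simp
  show "induced_map E' \<tau> n k (cmp ?S n m k g f) =
      cmp ?T n m k (induced_map E' \<tau> m k g) (induced_map E' \<tau> n m f)"
    unfolding ts(3) us(3)
    using ts(1,2) us(2) map_subst_in_terms_in[OF ts(1,2) us(2)] sub[OF ts(2)] sub[OF us(2)] eq
    by (simp only: cmp_presented induced_map_classes length_map)
qed

end


section \<open>Models\<close>

abbreviation left_inv :: "'a set \<Rightarrow> ('a \<Rightarrow> 'a \<Rightarrow> 'a) \<Rightarrow> 'a \<Rightarrow> 'a \<Rightarrow> 'a" where
  "left_inv R r x \<equiv> inv_into R (r x)"

lemma eval_term_eq_eval_alg: "eval_term R r xs t = eval_alg r (left_inv R r) ((!) xs) t"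
  by (induction t) auto

lemma nth_tuples: "xs \<in> tuples A n \<Longrightarrow> i < n \<Longrightarrow> xs ! i \<in> A"
  by (auto simp: tuples_def)

text \<open>By soundness, evaluation is constant on a class, so \<open>the_elem\<close> is applied
  to a singleton.\<close>

lemma model_of_classes:
  assumes sat: "satisfies R r (left_inv R r) E"
    and ts: "set ts \<subseteq> terms_in n" and xs: "xs \<in> tuples R n"
  shows "model_of R r n m (map (term_class E n) ts) xs = map (eval_term R r xs) ts"
proof -
  have "the_elem (eval_term R r xs ` term_class E n t) = eval_term R r xs t"
    if t: "t \<in> terms_in n" for t
  proof -
    have "eval_term R r xs s = eval_term R r xs t" if s: "s \<in> term_class E n t" for s
      using eval_alg_provably_eq_terms_in[OF sat, of t s n "(!) xs"] s t xs
      by (auto simp: mem_term_rel eval_term_eq_eval_alg nth_tuples)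
    moreover have "t \<in> term_class E n t"
      using t by (simp add: mem_term_rel provably_eq.refl)
    ultimately have "eval_term R r xs ` term_class E n t = {eval_term R r xs t}"
      by blast
    then show ?thesis
      by simp
  qed
  then show ?thesis
    using ts by (auto simp: model_of_def)
qed

text \<open>Compatibility with composition is the substitution lemma \<open>eval_alg_subst\<close>:
  evaluating a substituted term is evaluating at the tuple of values.\<close>

lemma theory_model_of:
  assumes sat: "satisfies R r (left_inv R r) E"
  shows "theory_model (presented_theory E) R (model_of R r)"
  unfolding theory_model_def
proof (intro conjI allI ballI impI)
  let ?T = "presented_theory E"
  have closed: "map (eval_term R r xs) ts \<in> tuples R m"
    if "length ts = m" "set ts \<subseteq> terms_in n" "xs \<in> tuples R n" for xs ts n m
  proof -
    have "eval_term R r xs t \<in> R" if t: "t \<in> set ts" for t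
    proof -
      have "vars t \<subseteq> {..<n}"
        using t \<open>set ts \<subseteq> _\<close> by (auto simp: terms_in_def)
      then show ?thesis
        unfolding eval_term_eq_eval_alg using \<open>xs \<in> _\<close>
        by (intro eval_alg_in[OF sat]) (auto intro: nth_tuples)
    qed
    then show ?thesis
      using that(1) by (auto simp: tuples_def)
  qed
  show "model_of R r n m f xs \<in> tuples R m" if "f \<in> Hom ?T n m" "xs \<in> tuples R n" for n m f xs
    using that by (elim HomE) (simp only: model_of_classes[OF sat] closed)
  show "model_of R r n n (idn ?T n) xs = xs" if xs: "xs \<in> tuples R n" for n xs
  proof -
    have "set (map Var [0..<n]) \<subseteq> terms_in n"
      by (auto simp: Var_in_terms_in)
    then have "model_of R r n n (idn ?T n) xs = map (eval_term R r xs) (map Var [0..<n])"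
      unfolding idn_presented using xs by (rule model_of_classes[OF sat])
    also have "\<dots> = xs"
      using xs by (auto simp: tuples_def list_eq_iff_nth_eq)
    finally show ?thesis .
  qed
  show "model_of R r n 1 (prj ?T n i) xs = [xs ! i]" if "i < n" "xs \<in> tuples R n" for n i xs
  proof -
    have "set [Var i] \<subseteq> terms_in n"
      using that(1) by (simp add: Var_in_terms_in)
    then show ?thesis
      unfolding prj_presented using that(2) by (simp only: model_of_classes[OF sat]) simp
  qed
  fix n m k f g xs
  assume "f \<in> Hom ?T n m" "g \<in> Hom ?T m k" and xs: "xs \<in> tuples R n"
  then obtain ts us where ts: "length ts = m" "set ts \<subseteq> terms_in n" "f = map (term_class E n) ts"
    and us: "length us = k" "set us \<subseteq> terms_in m" "g = map (term_class E m) us"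
    by (elim HomE)
  have "eval_term R r xs (subst ((!) ts) u) = eval_term R r (map (eval_term R r xs) ts) u"
    if "u \<in> set us" for u
    unfolding eval_term_eq_eval_alg eval_alg_subst
    using that ts(1) us(2)
    by (intro eval_alg_cong) (fastforce simp: terms_in_def eval_term_eq_eval_alg)
  then have "map (eval_term R r xs) (map (subst ((!) ts)) us) =
      map (eval_term R r (map (eval_term R r xs) ts)) us"
    by simp
  then show "model_of R r n k (cmp ?T n m k g f) xs = model_of R r m k g (model_of R r n m f xs)"
    unfolding ts(3) us(3)
    using ts(1,2) us(2) xs map_subst_in_terms_in[OF ts(1,2) us(2)] closed[OF ts(1,2) xs]
    by (simp only: cmp_presented model_of_classes[OF sat])
qed

text \<open>Both models are computed on representatives, so comparing them reduces to comparing the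
  values of \<open>\<tau> t\<close> and \<open>t\<close> for single terms.\<close>

lemma (in translation) same_model_pullback:
  assumes "satisfies R r (left_inv R r) E'" "satisfies R q (left_inv R q) E"
    and "\<And>n xs t. xs \<in> tuples R n \<Longrightarrow> t \<in> terms_in n \<Longrightarrow>
      eval_term R r xs (\<tau> t) = eval_term R q xs t"
  shows "same_model (presented_theory E) R
    (pullback_model (induced_map E' \<tau>) (model_of R r)) (model_of R q)"
  unfolding same_model_def pullback_model_def
proof (intro allI ballI)
  fix n m f xs assume "f \<in> Hom (presented_theory E) n m" and xs: "xs \<in> tuples R n"
  then obtain ts where ts: "set ts \<subseteq> terms_in n" "f = map (term_class E n) ts"
    by (elim HomE)
  have "set (map \<tau> ts) \<subseteq> terms_in n"
    using ts(1) by (auto simp: translate_in_terms_in)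
  then have "model_of R r n m (induced_map E' \<tau> n m f) xs = map (eval_term R r xs) (map \<tau> ts)"
    unfolding ts(2) induced_map_classes[OF ts(1)] using xs by (rule model_of_classes[OF assms(1)])
  also have "\<dots> = map (eval_term R q xs) ts"
    using ts(1) assms(3)[OF xs] by auto
  also have "\<dots> = model_of R q n m f xs"
    unfolding ts(2) using model_of_classes[OF assms(2) ts(1) xs] by simp
  finally show "model_of R r n m (induced_map E' \<tau> n m f) xs = model_of R q n m f xs" .
qed


section \<open>Racks and quandles\<close>

lemma satisfies_rack_eqs_iff:
  "satisfies A r l rack_eqs \<longleftrightarrow>
     (\<forall>x\<in>A. \<forall>y\<in>A. r x y \<in> A \<and> l x y \<in> A \<and> r x (l x y) = y \<and> l x (r x y) = y) \<and>
     (\<forall>x\<in>A. \<forall>y\<in>A. \<forall>z\<in>A. r (r x y) (r x z) = r x (r y z))" (is "?L \<longleftrightarrow> ?R")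
proof
  assume L: ?L
  have eqs: "r x (l x y) = y \<and> l x (r x y) = y \<and> r (r x y) (r x z) = r x (r y z)"
    if "x \<in> A" "y \<in> A" "z \<in> A" for x y z
  proof -
    \<comment> \<open>The equations use variables 0, 1, 2; the value \<open>z\<close> is repeated
      beyond them to keep the whole range in \<open>A\<close>.\<close>
    define \<rho> where "\<rho> i = (if i = 0 then x else if i = 1 then y else z)" for i :: nat
    have "range \<rho> \<subseteq> A"
      using that by (auto simp: \<rho>_def)
    then have "\<forall>(s, t)\<in>rack_eqs. eval_alg r l \<rho> s = eval_alg r l \<rho> t"
      using L unfolding satisfies_def by blast
    then show ?thesis
      by (simp add: rack_eqs_def Let_def \<rho>_def)
  qed
  moreover have "\<forall>x\<in>A. \<forall>y\<in>A. r x y \<in> A \<and> l x y \<in> A"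
    using L unfolding satisfies_def by blast
  ultimately show ?R
    by blast
next
  assume ?R
  moreover have "\<rho> i \<in> A" if "range \<rho> \<subseteq> A" for \<rho> :: "nat \<Rightarrow> 'a" and i
    using that by auto
  ultimately show ?L
    unfolding satisfies_def rack_eqs_def by (simp add: Let_def)
qed

lemma satisfies_quandle_eqs_iff:
  "satisfies A r l quandle_eqs \<longleftrightarrow> satisfies A r l rack_eqs \<and> (\<forall>x\<in>A. r x x = x)"
proof -
  have "(\<forall>\<rho>. range \<rho> \<subseteq> A \<longrightarrow> r (\<rho> 0) (\<rho> 0) = \<rho> 0) \<longleftrightarrow> (\<forall>x\<in>A. r x x = x)" (is "?L \<longleftrightarrow> ?R")
  proof
    show ?R if ?L
    proof
      fix x assume "x \<in> A"
      then show "r x x = x"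
        using that[rule_format, of "\<lambda>_. x"] by auto
    qed
  qed auto
  then show ?thesis
    unfolding satisfies_def quandle_eqs_def by auto
qed

text \<open>\<open>l\<close> is forced by \<open>r\<close> on \<open>A\<close>, since
  \<open>l x\<close> inverts \<open>r x\<close> there. This later identifies the left inverses of
  the box operation with an explicit formula.\<close>

lemma satisfies_rack_eqs_inv_into:
  assumes "satisfies A r l rack_eqs" "x \<in> A" "y \<in> A"
  shows "inv_into A (r x) y = l x y"
  using assms unfolding satisfies_rack_eqs_iff
  by (intro inv_into_f_eq inj_on_inverseI[of _ "l x"]) auto

text \<open>This lemma and \<open>satisfies_of_rack\<close> pass between bijective left
  multiplications and the two cancellation equations.\<close>

lemma rack_of_satisfies:
  assumes "satisfies A r l rack_eqs"
  shows "rack A r"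
  unfolding rack_def
proof (intro conjI ballI)
  show "bij_betw (r x) A A" if "x \<in> A" for x
    using assms that unfolding satisfies_rack_eqs_iff
    by (intro bij_betw_byWitness[where f' = "l x"]) auto
qed (use assms in \<open>auto simp: satisfies_rack_eqs_iff\<close>)

lemma satisfies_of_rack:
  assumes "rack A r"
  shows "satisfies A r (left_inv A r) rack_eqs"
proof -
  have "bij_betw (r x) A A" if "x \<in> A" for x
    using assms that by (simp add: rack_def)
  then have "r x y \<in> A \<and> left_inv A r x y \<in> A \<and> r x (left_inv A r x y) = y \<and>
      left_inv A r x (r x y) = y" if "x \<in> A" "y \<in> A" for x y
    using that by (metis bij_betw_apply bij_betw_inv_into bij_betw_inv_into_left bij_betw_inv_into_right)
  then show ?thesis
    using assms unfolding satisfies_rack_eqs_iff rack_def by metis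
qed

section \<open>The box structure on an algebra satisfying the rack equations\<close>

locale rack_algebra =
  fixes A :: "'a set" and r l :: "'a \<Rightarrow> 'a \<Rightarrow> 'a"
  assumes satisfies: "satisfies A r l rack_eqs"
begin

lemma closed [simp]: "x \<in> A \<Longrightarrow> y \<in> A \<Longrightarrow> r x y \<in> A" "x \<in> A \<Longrightarrow> y \<in> A \<Longrightarrow> l x y \<in> A"
  and r_l [simp]: "x \<in> A \<Longrightarrow> y \<in> A \<Longrightarrow> r x (l x y) = y"
  and l_r [simp]: "x \<in> A \<Longrightarrow> y \<in> A \<Longrightarrow> l x (r x y) = y"
  and distrib [simp]: "x \<in> A \<Longrightarrow> y \<in> A \<Longrightarrow> z \<in> A \<Longrightarrow> r (r x y) (r x z) = r x (r y z)"
  using satisfies by (auto simp: satisfies_rack_eqs_iff)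

definition F_inv :: "'a \<Rightarrow> 'a" where
  "F_inv x = l x x"

definition box :: "'a \<Rightarrow> 'a \<Rightarrow> 'a" where
  "box x y = F_inv (r x y)"

text \<open>The preimage of \<open>y\<close> under \<open>box x\<close>: first undo
  \<open>F_inv\<close> by squaring, then undo \<open>r x\<close>.\<close>

definition box_linv :: "'a \<Rightarrow> 'a \<Rightarrow> 'a" where
  "box_linv x y = l x (r y y)"

lemma F_inv_closed [simp]: "x \<in> A \<Longrightarrow> F_inv x \<in> A"
  by (simp add: F_inv_def)

text \<open>Self-distributivity at \<open>x\<close>, \<open>x\<close>, \<open>l x y\<close>, where
  \<open>r x (l x y)\<close> collapses to \<open>y\<close>.\<close>

lemma F_acts:
  assumes "x \<in> A" "y \<in> A"
  shows "r (r x x) y = r x y"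
  using assms distrib[of x x "l x y"] by simp

text \<open>By \<open>F_acts\<close>, \<open>r x x = r (r x x) x\<close>; cancelling
  \<open>r (r x x)\<close> leaves \<open>x\<close>.\<close>

lemma F_inv_F [simp]:
  assumes "x \<in> A"
  shows "F_inv (r x x) = x"
  using assms l_r[of "r x x" x] by (simp add: F_inv_def F_acts)

text \<open>Since \<open>r x (F_inv x) = x\<close>, self-distributivity shows that
  \<open>r x\<close> takes the square of \<open>F_inv x\<close> to \<open>r x x\<close>; cancel
  \<open>r x\<close>.\<close>

lemma F_F_inv [simp]:
  assumes "x \<in> A"
  shows "r (F_inv x) (F_inv x) = x"
proof -
  have "r x (r (F_inv x) (F_inv x)) = r x x"
    using assms distrib[of x "F_inv x" "F_inv x"] by (simp add: F_inv_def)
  then show ?thesis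
    using assms l_r[of x "r (F_inv x) (F_inv x)"] by simp
qed

lemma F_inv_acts:
  assumes "x \<in> A" "y \<in> A"
  shows "r (F_inv x) y = r x y"
  using assms F_acts[of "F_inv x" y] by simp

text \<open>\<open>r x\<close> preserves the operation, hence commutes with \<open>F\<close>, hence
  with its inverse.\<close>

lemma r_F_inv:
  assumes "x \<in> A" "y \<in> A"
  shows "r x (F_inv y) = F_inv (r x y)"
  using assms distrib[of x "F_inv y" "F_inv y"] F_inv_F[of "r x (F_inv y)"] by simp

text \<open>Pulling \<open>F_inv\<close> outwards and dropping it in acting position turns both
  sides of self-distributivity into \<open>F_inv (F_inv (r x (r y z)))\<close>. Idempotence is
  \<open>F_inv_F\<close>.\<close>

lemma satisfies_box: "satisfies A box box_linv quandle_eqs"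
proof -
  have "box_linv x (box x y) = y" if "x \<in> A" "y \<in> A" for x y
    using that by (simp add: box_def box_linv_def)
  then show ?thesis
    unfolding satisfies_quandle_eqs_iff satisfies_rack_eqs_iff
    by (simp add: box_def box_linv_def r_F_inv F_inv_acts)
qed

lemma box_op_eq_box: "x \<in> A \<Longrightarrow> y \<in> A \<Longrightarrow> box_op A r x y = box x y"
  unfolding box_op_def box_def canonical_aut_def
  by (intro inv_into_f_eq inj_on_inverseI[of _ F_inv]) auto

lemma satisfies_box_op: "satisfies A (box_op A r) box_linv quandle_eqs"
proof -
  have "box x y \<in> A" if "x \<in> A" "y \<in> A" for x y
    using that by (simp add: box_def)
  then show ?thesis
    using satisfies_box unfolding satisfies_quandle_eqs_iff satisfies_rack_eqs_iff
    by (simp add: box_op_eq_box)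
qed

text \<open>\<open>box_term\<close> is the box structure written as syntax. This links the algebraic
  computation with the translation of terms.\<close>

lemma eval_alg_box_term: "eval_alg r l \<rho> (box_term t) = eval_alg box box_linv \<rho> t"
  by (induction t) (auto simp: F_term_def F_inv_term_def F_inv_def box_def box_linv_def)

end

section \<open>The box translation and its composite with the inclusion\<close>

lemma vars_box_term: "vars (box_term t) = vars t"
  by (induction t) (auto simp: F_term_def F_inv_term_def)

lemma box_term_subst: "box_term (subst \<sigma> t) = subst (\<lambda>i. box_term (\<sigma> i)) (box_term t)"
  by (induction t) (auto simp: F_term_def F_inv_term_def)

text \<open>The box structure on the term algebra of racks satisfies the quandle equations, so
  soundness gives \<open>s\<close> and \<open>t\<close> equal values in it. At the generic
  assignment these values are the classes of \<open>box_term s\<close> and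
  \<open>box_term t\<close>.\<close>

lemma provably_eq_box_term:
  assumes "provably_eq quandle_eqs s t"
  shows "provably_eq rack_eqs (box_term s) (box_term t)"
proof -
  interpret rack_algebra "range (eq_class rack_eqs)" "class_op rack_eqs" "class_linv rack_eqs"
    by unfold_locales (rule satisfies_term_algebra)
  let ?\<rho> = "\<lambda>i. eq_class rack_eqs (Var i)"
  have "eval_alg box box_linv ?\<rho> s = eval_alg box box_linv ?\<rho> t"
    using satisfies_box assms by (rule eval_alg_provably_eq) auto
  then have "eq_class rack_eqs (subst Var (box_term s)) = eq_class rack_eqs (subst Var (box_term t))"
    by (simp only: eval_alg_box_term[symmetric] eval_alg_eq_class)
  then show ?thesis
    by (simp add: subst_Var eq_class_eq_iff)
qed

text \<open>In the term algebra of quandles squaring is the identity, so \<open>F_inv\<close> is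
  too, and the box structure is the original one. Comparing values at the generic assignment gives
  the derivation.\<close>

lemma provably_eq_quandle_box_term: "provably_eq quandle_eqs (box_term t) t"
proof -
  interpret rack_algebra "range (eq_class quandle_eqs)" "class_op quandle_eqs" "class_linv quandle_eqs"
    using satisfies_term_algebra[of quandle_eqs] by unfold_locales (auto simp: satisfies_quandle_eqs_iff)
  let ?A = "range (eq_class quandle_eqs)" and ?\<rho> = "\<lambda>i. eq_class quandle_eqs (Var i)"
  have idem: "class_op quandle_eqs x x = x" if "x \<in> ?A" for x
    using satisfies_term_algebra[of quandle_eqs] that unfolding satisfies_quandle_eqs_iff by blast
  have "F_inv x = x" if "x \<in> ?A" for x
    using that F_inv_F[of x] by (simp add: idem)
  then have "box x y = class_op quandle_eqs x y" "box_linv x y = class_linv quandle_eqs x y"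
    if "x \<in> ?A" "y \<in> ?A" for x y
    using that closed(1)[of x y] by (simp_all add: box_def box_linv_def idem)
  \<comment> \<open>The two structures are known to agree only on \<open>?A\<close>, so the
    induction needs the values of subterms to lie there.\<close>
  moreover have "eval_alg (class_op quandle_eqs) (class_linv quandle_eqs) ?\<rho> t \<in> ?A" for t
    by (simp add: eval_alg_eq_class)
  ultimately have "eval_alg box box_linv ?\<rho> t =
      eval_alg (class_op quandle_eqs) (class_linv quandle_eqs) ?\<rho> t"
    by (induction t) simp_all
  then show ?thesis
    by (simp add: eval_alg_box_term[symmetric] eval_alg_eq_class subst_Var eq_class_eq_iff)
qed

interpretation box: translation quandle_eqs rack_eqs box_term
  by unfold_locales (simp_all add: vars_box_term box_term_subst provably_eq_box_term)

interpretation supset: translation rack_eqs quandle_eqs "\<lambda>t. t"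
  by unfold_locales (auto simp: quandle_eqs_def elim: provably_eq_mono)

text \<open>On representatives the composite replaces each term \<open>t\<close> by
  \<open>box_term t\<close>, which lies in the same quandle class.\<close>

lemma supset_mor_box_mor:
  assumes "f \<in> Hom Quan n m"
  shows "supset_mor n m (box_mor n m f) = f"
proof -
  obtain ts where ts: "set ts \<subseteq> terms_in n" "f = map (term_class quandle_eqs n) ts"
    using assms unfolding Quan_def by (rule HomE)
  have "set (map box_term ts) \<subseteq> terms_in n"
    using ts(1) by (auto simp: box.translate_in_terms_in)
  then have "supset_mor n m (box_mor n m f) = map (term_class quandle_eqs n) (map box_term ts)"
    unfolding ts(2) supset_mor_def box_mor_def
    using ts(1) by (simp only: box.induced_map_classes supset.induced_map_classes list.map_ident)
  also have "\<dots> = f"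
    unfolding ts(2) map_map o_def using ts(1)
    by (intro map_cong refl term_class_eqI provably_eq_quandle_box_term)
      (auto simp: box.translate_in_terms_in)
  finally show ?thesis .
qed

lemma box_model:
  assumes "rack R r"
  shows "quandle R (box_op R r)"
    and "same_model Quan R (pullback_model box_mor (model_of R r)) (model_of R (box_op R r))"
proof -
  interpret rack_algebra R r "left_inv R r"
    using assms by unfold_locales (rule satisfies_of_rack)
  show quandle: "quandle R (box_op R r)"
    using satisfies_box_op unfolding quandle_def satisfies_quandle_eqs_iff
    by (blast intro: rack_of_satisfies)
  then have sat: "satisfies R (box_op R r) (left_inv R (box_op R r)) quandle_eqs"
    unfolding satisfies_quandle_eqs_iff quandle_def by (blast intro: satisfies_of_rack)
  \<comment> \<open>\<open>model_of\<close> interprets \<open>LInv\<close> by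
    \<open>inv_into\<close> of the box operation, whereas the translation computes
    \<open>box_linv\<close>; uniqueness of inverses reconciles them on \<open>R\<close>.\<close>
  have linv: "left_inv R (box_op R r) x y = box_linv x y" if "x \<in> R" "y \<in> R" for x y
    using satisfies_box_op that unfolding satisfies_quandle_eqs_iff
    by (blast intro: satisfies_rack_eqs_inv_into)
  show "same_model Quan R (pullback_model box_mor (model_of R r)) (model_of R (box_op R r))"
    unfolding Quan_def box_mor_def
  proof (rule box.same_model_pullback[OF satisfies sat])
    fix n t and xs :: "'a list" assume xs: "xs \<in> tuples R n" and "t \<in> terms_in n"
    then have "vars t \<subseteq> {..<n}"
      by (simp add: terms_in_def)
    \<comment> \<open>Agreement holds only on \<open>R\<close>; the bound on the variables of
      \<open>t\<close> keeps all subterm values there.\<close>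
    then have "eval_alg box box_linv ((!) xs) t = eval_alg (box_op R r) (left_inv R (box_op R r)) ((!) xs) t"
    proof (induction t)
      case (Op s t)
      then show ?case
        using xs by (auto simp: box_op_eq_box intro!: box_op_eq_box[symmetric] eval_alg_in[OF sat] nth_tuples)
    next
      case (LInv s t)
      then show ?case
        using xs by (auto intro!: linv[symmetric] eval_alg_in[OF sat] nth_tuples)
    qed simp
    then show "eval_term R r xs (box_term t) = eval_term R (box_op R r) xs t"
      by (simp add: eval_term_eq_eval_alg eval_alg_box_term)
  qed
qed

theorem proposition3p6:
  "lawvere_theory Quan \<and> lawvere_theory Rack \<and>
   theory_morphism Quan Rack box_mor \<and>
   theory_morphism Rack Quan supset_mor \<and>
   (\<forall>n m. \<forall>f\<in>Hom Quan n m. supset_mor n m (box_mor n m f) = f) \<and>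
   (\<forall>(R :: 'a set) r. rack R r \<longrightarrow>
      theory_model Rack R (model_of R r) \<and> quandle R (box_op R r) \<and>
      same_model Quan R (pullback_model box_mor (model_of R r)) (model_of R (box_op R r))) \<and>
   (\<forall>(Q :: 'a set) q. quandle Q q \<longrightarrow>
      theory_model Quan Q (model_of Q q) \<and>
      same_model Rack Q (pullback_model supset_mor (model_of Q q)) (model_of Q q))"
proof (intro conjI allI ballI impI)
  show "lawvere_theory Quan" "lawvere_theory Rack"
    by (simp_all add: Quan_def Rack_def lawvere_theory_presented)
  show "theory_morphism Quan Rack box_mor"
    unfolding Quan_def Rack_def box_mor_def by (rule box.theory_morphism_induced_map)
  show "theory_morphism Rack Quan supset_mor"
    unfolding Quan_def Rack_def supset_mor_def by (rule supset.theory_morphism_induced_map)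
  show "supset_mor n m (box_mor n m f) = f" if "f \<in> Hom Quan n m" for n m f
    using that by (rule supset_mor_box_mor)
  fix R :: "'a set" and r assume rack: "rack R r"
  show "theory_model Rack R (model_of R r)"
    unfolding Rack_def using rack by (intro theory_model_of satisfies_of_rack)
  show "quandle R (box_op R r)"
    "same_model Quan R (pullback_model box_mor (model_of R r)) (model_of R (box_op R r))"
    using rack by (fact box_model)+
next
  fix Q :: "'a set" and q assume "quandle Q q"
  \<comment> \<open>The comparison along \<open>supset_mor\<close> evaluates the same operations
    once as a quandle and once as a rack.\<close>
  then have sat: "satisfies Q q (left_inv Q q) rack_eqs" "satisfies Q q (left_inv Q q) quandle_eqs"
    unfolding satisfies_quandle_eqs_iff quandle_def by (blast intro: satisfies_of_rack)+
  show "theory_model Quan Q (model_of Q q)"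
    unfolding Quan_def using sat(2) by (rule theory_model_of)
  show "same_model Rack Q (pullback_model supset_mor (model_of Q q)) (model_of Q q)"
    unfolding Rack_def supset_mor_def using sat(2,1) by (rule supset.same_model_pullback) simp
qed

end
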